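(* The opinion dynamics in which the source of information of the agents of group $B$ has a bias $\xi\in\mathbb{R}$, $$\begin{bmatrix}\boldsymbol\mu_{A,t}\\ \boldsymbol\mu_{B,t}\end{bmatrix}=\tilde{\mathbf W}\begin{bmatrix}\boldsymbol\mu_{A,t-1}\\ \boldsymbol\mu_{B,t-1}\end{bmatrix}+\begin{bmatrix}\tilde{\mathbf w}_A\,\theta^*\\ \tilde{\mathbf w}_B\,(\theta^*+\xi)\end{bmatrix},$$ with $\tilde{\mathbf W}$ and $\tilde{\mathbf w}_A,\tilde{\mathbf w}_B$ as defined in the context, always converge and, at the steady state, $$\boldsymbol\mu=(\mathbf I-\tilde{\mathbf W})^{-1}\begin{bmatrix}\tilde{\mathbf w}_A\,\theta^*\\ \tilde{\mathbf w}_B\,(\theta^*+\xi)\end{bmatrix}.$$ For the generic agent $i\in N$ one can write $$\mu_i=\tilde b_i\,\theta^*+\tilde b_i^{B}\,\xi,\qquad \tilde b_i:=\sum_{j\in N}\tilde b_{ij}\,\tilde w_j,\quad \tilde b_i^{B}:=\sum_{k\in B}\tilde b_{ik}\,\tilde w_k,$$ where $\tilde b_{ij}$ is the $(i,j)$ entry of $(\mathbf I-\tilde{\mathbf W})^{-1}$.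
   Context: $\theta^*\in\Theta\subset\mathbb{R}$ is the true state of the world. The set of agents $N=\{1,\dots,n\}$ is partitioned into two groups $A=\{1,\dots,n_A\}$ and $B=\{n_A+1,\dots,n\}$, of sizes $n_A$ and $n_B$, with $n_A+n_B=n$. The interaction matrix $\mathbf W=(w_{ij})_{i,j\in N}$ is a non-negative $n\times n$ matrix with $w_{ij}\in[0,1]$, possibly asymmetric; $w_{ij}$ is the extent to which $i$ pays attention to $j$'s opinion. The vector $\mathbf w=(w_i)_{i\in N}=(\mathbf w_A,\mathbf w_B)$ collects the weights $w_i\in[0,1]$ that agents give to their source of information. It is assumed that $\sum_{j\in N\setminus\{i\}}w_{ij}+w_i=1$ for each $i\in N$, so that $\mathbf W$ is sub-stochastic, and that $w_i>0$ for at least one $i\in N$. Write $\mathbf W=\begin{bmatrix}\mathbf W^{AA}&\mathbf W^{AB}\\ \mathbf W^{BA}&\mathbf W^{BB}\end{bmatrix}$ in blocks according to the partition. The parameters $\alpha\in[0,1]$ (intensity of in-group identity) and $\beta\in[-1,0]$ (intensity of out-group conflict) are such that $1-\alpha-\beta\in[0,1]$. Define $$\tilde{\mathbf W}:=\begin{bmatrix}\alpha\mathbf W^{AA}&\beta\mathbf W^{AB}\\ \beta\mathbf W^{BA}&\alpha\mathbf W^{BB}\end{bmatrix},\qquad \tilde{\mathbf w}=(\tilde w_i)_{i\in N}:=(1-\alpha-\beta)\,\mathbf w,\qquad \tilde{\mathbf w}_C:=(\tilde w_i)_{i\in C}\ \ (C=A,B).$$ $\boldsymbol\mu_{C,t}$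 is the vector of opinions at time $t$ of the agents of group $C$, and $\boldsymbol\mu=(\mu_i)_{i\in N}$ is the steady-state (long-run) opinion vector, i.e. a vector unchanged by the updating.
   Formalization: For α = 1 it is additionally assumed that from each agent, along links of positive weight, one reaches an agent whose row of W sums to less than 1 or, if β > −1, a member of the other group; otherwise I − W̃ is singular. *)

theory Defs
  imports "HOL-Analysis.Analysis"
begin

definition tilde_W ::
  "'n set \<Rightarrow> 'n set \<Rightarrow> real \<Rightarrow> real \<Rightarrow> real^'n^'n \<Rightarrow> real^('n::finite)^'n" where
  "tilde_W A B \<alpha> \<beta> W =
     (\<chi> i j. if i \<in> A \<and> j \<in> A \<or> i \<in> B \<and> j \<in> B then \<alpha> * W $ i $ j else \<beta> * W $ i $ j)"

definition tilde_w :: "real \<Rightarrow> real \<Rightarrow> real^'n \<Rightarrow> real^('n::finite)" where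
  "tilde_w \<alpha> \<beta> w = (1 - \<alpha> - \<beta>) *\<^sub>R w"

definition biased_input :: "'n set \<Rightarrow> real \<Rightarrow> real \<Rightarrow> real^'n \<Rightarrow> real^('n::finite)" where
  "biased_input B \<theta> \<xi> v = (\<chi> i. if i \<in> B then v $ i * (\<theta> + \<xi>) else v $ i * \<theta>)"

definition opinion_path :: "real^'n^'n \<Rightarrow> real^'n \<Rightarrow> (nat \<Rightarrow> real^('n::finite)) \<Rightarrow> bool" where
  "opinion_path M s \<mu> \<longleftrightarrow> (\<forall>t. \<mu> (Suc t) = M *v \<mu> t + s)"

definition steady_state :: "real^'n^'n \<Rightarrow> real^'n \<Rightarrow> real^('n::finite) \<Rightarrow> bool" where
  "steady_state M s m \<longleftrightarrow> m = M *v m + s"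

definition leontief :: "real^'n^'n \<Rightarrow> real^('n::finite)^'n" where
  "leontief M = matrix_inv (mat 1 - M)"

definition b_coeff :: "real^'n^'n \<Rightarrow> real^'n \<Rightarrow> 'n \<Rightarrow> real" where
  "b_coeff M v i = (\<Sum>j\<in>UNIV. leontief M $ i $ j * v $ (j::'n::finite))"

definition b_coeff_on :: "'n set \<Rightarrow> real^'n^'n \<Rightarrow> real^'n \<Rightarrow> 'n \<Rightarrow> real" where
  "b_coeff_on B M v i = (\<Sum>k\<in>B. leontief M $ i $ k * v $ (k::'n::finite))"

definition listens :: "real^'n^'n \<Rightarrow> ('n \<times> 'n::finite) set" where
  "listens W = {(i, j). W $ i $ j > 0}"

text \<open>
  Vacuous for \<open>\<alpha> < 1\<close>. For \<open>\<alpha> = 1\<close>: from every agent, following attention links, one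
  reaches an agent who does not spend all her weight on opinions or, unless \<open>\<beta> = -1\<close>, a member
  of the other group. This cannot be weakened. If it fails for an agent \<open>i\<close>, let \<open>S\<close> be the set
  of agents reachable from \<open>i\<close>. Rows of \<open>W\<close> in \<open>S\<close> sum to 1 and vanish outside \<open>S\<close>, and either
  \<open>S\<close> lies in one group or \<open>\<beta> = -1\<close>. So \<open>1\<close> is an eigenvalue of the diagonal block of
  \<open>tilde_W\<close> on \<open>S\<close> (eigenvector \<open>1\<close> on the group of \<open>i\<close>, \<open>-1\<close> on the other group), and
  \<open>I - tilde_W\<close> is singular.
\<close>
definition no_isolated_cluster ::
  "'n set \<Rightarrow> real \<Rightarrow> real \<Rightarrow> real^'n^('n::finite) \<Rightarrow> bool" where
  "no_isolated_cluster A \<alpha> \<beta> W \<longleftrightarrow>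
     (\<alpha> = 1 \<longrightarrow>
        (\<forall>i. \<exists>j. (i, j) \<in> (listens W)\<^sup>* \<and>
           ((\<Sum>k\<in>UNIV. W $ j $ k) < 1 \<or> -1 < \<beta> \<and> (i \<in> A) \<noteq> (j \<in> A))))"

end

theory Submission
  imports Defs
begin

text \<open>
  Write \<open>M\<close> for \<^term>\<open>tilde_W A B \<alpha> \<beta> W\<close>. Entrywise \<open>\<bar>M\<bar> \<le> W\<close>, so the row sums of the powers of
  \<open>\<bar>M\<bar>\<close> decrease to a fixed point \<open>c \<ge> 0\<close> of \<open>\<bar>M\<bar>\<close>. By the maximum principle, the agents at which
  \<open>c\<close> is maximal are closed under attention links and, if \<open>c \<noteq> 0\<close>, have \<open>\<bar>M\<bar>\<close>-row sum 1. But
  every agent reaches one whose \<open>\<bar>M\<bar>\<close>-row sum is smaller than 1, so \<open>c = 0\<close> and \<open>M\<^sup>t x\<close> tends to 0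
  for all \<open>x\<close>. This gives both the invertibility of \<open>I - M\<close> and the convergence.
\<close>

lemma maximum_principle_fixpoint_zero:
  fixes P W :: "real^'n::finite^'n" and c :: "real^'n"
  assumes P: "\<And>i j. 0 \<le> P $ i $ j" "\<And>i j. P $ i $ j \<le> W $ i $ j"
    and W: "\<And>i. (\<Sum>j\<in>UNIV. W $ i $ j) \<le> 1"
    and reach: "\<And>i. \<exists>k. (i, k) \<in> (listens W)\<^sup>* \<and> (\<Sum>j\<in>UNIV. P $ k $ j) < 1"
    and nonneg: "\<And>i. 0 \<le> c $ i"
    and fixpoint: "P *v c = c"
  shows "c = 0"
proof -
  define m where "m = Max (range (($) c))"
  have le_m: "c $ i \<le> m" for i
    unfolding m_def by (intro Max_ge) auto
  have "m \<in> range (($) c)"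
    unfolding m_def by (intro Max_in) auto
  then obtain i0 where i0: "c $ i0 = m" by auto
  have m_nonneg: "0 \<le> m" using nonneg[of i0] i0 by simp
  have P_le_1: "(\<Sum>j\<in>UNIV. P $ i $ j) \<le> 1" for i
    using sum_mono[of UNIV "\<lambda>j. P $ i $ j" "\<lambda>j. W $ i $ j"] P(2) W[of i] by fastforce
  have fix_sum: "(\<Sum>j\<in>UNIV. P $ i $ j * c $ j) = c $ i" for i
    using arg_cong[OF fixpoint, of "\<lambda>v. v $ i"] by (simp add: matrix_vector_mult_def)
  \<comment> \<open>Where \<open>c $ i = m\<close>, this reads \<open>m \<le> r * m\<close> with
    \<open>r\<close> the row sum of \<open>P\<close>; once \<open>m\<close> is positive it forces
    \<open>r\<close> to be 1.\<close>
  have le_row: "c $ i \<le> (\<Sum>j\<in>UNIV. P $ i $ j) * m" for i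
    unfolding fix_sum[of i, symmetric] sum_distrib_right
    by (intro sum_mono mult_left_mono le_m P)
  have "m = 0"
  proof (rule ccontr)
    assume "m \<noteq> 0"
    then have m_pos: "0 < m" using m_nonneg by simp
    have row: "(\<Sum>j\<in>UNIV. P $ i $ j) = 1" if "c $ i = m" for i
    proof -
      have "1 \<le> (\<Sum>j\<in>UNIV. P $ i $ j)"
        using le_row[of i] that m_pos by simp
      then show ?thesis using P_le_1[of i] by simp
    qed
    have closed: "c $ j = m" if i: "c $ i = m" and ij: "(i, j) \<in> listens W" for i j
    proof -
      \<comment> \<open>Row \<open>i\<close> of \<open>P\<close> already sums to 1 and lies below
        row \<open>i\<close> of \<open>W\<close>, whose sum is at most 1, so the two rows agree.
        Hence a link of \<open>W\<close> carries positive weight in \<open>P\<close>.\<close>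
      have "(\<Sum>j\<in>UNIV. W $ i $ j - P $ i $ j) \<le> 0"
        using W[of i] row[OF i] by (simp add: sum_subtractf)
      then have "(\<Sum>j\<in>UNIV. W $ i $ j - P $ i $ j) = 0"
        by (intro antisym sum_nonneg) (simp_all add: P)
      then have "W $ i $ j - P $ i $ j = 0"
        by (subst (asm) sum_nonneg_eq_0_iff) (auto simp: P)
      then have P_pos: "0 < P $ i $ j"
        using ij by (simp add: listens_def)
      \<comment> \<open>The maximum \<open>m\<close> is a weighted average of the
        \<open>c $ j\<close>, so every gap \<open>m - c $ j\<close> with positive weight
        vanishes.\<close>
      have "(\<Sum>j\<in>UNIV. P $ i $ j * (m - c $ j)) = 0"
        using fix_sum[of i] row[OF i] i
        by (simp add: right_diff_distrib sum_subtractf flip: sum_distrib_right)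
      then have "P $ i $ j * (m - c $ j) = 0"
        by (subst (asm) sum_nonneg_eq_0_iff) (auto simp: P le_m)
      then show ?thesis using P_pos by simp
    qed
    obtain k where k: "(i0, k) \<in> (listens W)\<^sup>*" "(\<Sum>j\<in>UNIV. P $ k $ j) < 1"
      using reach by blast
    from k(1) have "c $ k = m"
      by (induction rule: rtrancl_induct) (auto simp: i0 closed)
    then show False using row[of k] k(2) by simp
  qed
  then show ?thesis
    using le_m nonneg by (auto simp: vec_eq_iff intro: antisym)
qed

text \<open>Starting from the all-ones vector gives monotonicity: the first step decreases because
  row sums are at most 1, and a nonnegative \<open>P\<close> preserves the inequality. The
  componentwise limit is a fixed point by continuity, hence zero by the maximum principle.\<close>

lemma powers_one_tendsto_zero:
  fixes P W :: "real^'n::finite^'n"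
  assumes P: "\<And>i j. 0 \<le> P $ i $ j" "\<And>i j. P $ i $ j \<le> W $ i $ j"
    and W: "\<And>i. (\<Sum>j\<in>UNIV. W $ i $ j) \<le> 1"
    and reach: "\<And>i. \<exists>k. (i, k) \<in> (listens W)\<^sup>* \<and> (\<Sum>j\<in>UNIV. P $ k $ j) < 1"
  shows "(\<lambda>t. ((*v) P ^^ t) 1) \<longlonglongrightarrow> 0"
proof -
  define c where "c t = ((*v) P ^^ t) 1" for t
  have c_Suc: "c (Suc t) = P *v c t" for t by (simp add: c_def)
  have nonneg: "0 \<le> c t $ i" for t i
  proof (induction t arbitrary: i)
    case 0
    show ?case by (simp add: c_def)
  next
    case (Suc t)
    then show ?case
      by (auto simp: c_Suc matrix_vector_mult_def P intro!: sum_nonneg)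
  qed
  have decr: "c (Suc t) $ i \<le> c t $ i" for t i
  proof (induction t arbitrary: i)
    case 0
    have "(\<Sum>j\<in>UNIV. P $ i $ j) \<le> (\<Sum>j\<in>UNIV. W $ i $ j)"
      by (intro sum_mono P)
    also note W[of i]
    finally show ?case by (simp add: c_def matrix_vector_mult_def)
  next
    case (Suc t)
    have "(P *v c (Suc t)) $ i \<le> (P *v c t) $ i"
      unfolding matrix_vector_mult_def by (auto intro!: sum_mono mult_left_mono Suc.IH P)
    then show ?case by (simp only: c_Suc)
  qed
  have "\<exists>l. (\<lambda>t. c t $ i) \<longlonglongrightarrow> l" for i
    using decseq_convergent[of "\<lambda>t. c t $ i" 0] nonneg decr by (metis decseq_Suc_iff)
  then obtain l where l: "\<And>i. (\<lambda>t. c t $ i) \<longlonglongrightarrow> l i" by metis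
  have lim: "c \<longlonglongrightarrow> (\<chi> i. l i)"
    by (rule vec_tendstoI) (simp add: l)
  have "(\<lambda>t. P *v c t) \<longlonglongrightarrow> P *v (\<chi> i. l i)"
    by (intro isCont_tendsto_compose[OF _ lim] linear_continuous_at matrix_vector_mul_bounded_linear)
  moreover have "(\<lambda>t. P *v c t) \<longlonglongrightarrow> (\<chi> i. l i)"
    using LIMSEQ_Suc[OF lim] by (simp add: c_Suc)
  ultimately have "P *v (\<chi> i. l i) = (\<chi> i. l i)"
    by (rule LIMSEQ_unique)
  moreover have "0 \<le> (\<chi> i. l i) $ i" for i
    using l[of i] nonneg by (auto intro: LIMSEQ_le_const)
  ultimately have "(\<chi> i. l i) = 0"
    using maximum_principle_fixpoint_zero[OF P W reach] by blast
  then show ?thesis using lim by (simp add: c_def[abs_def])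
qed

text \<open>By the triangle inequality, the iterates of \<open>\<bar>M\<bar>\<close> on the all-ones
  vector, scaled by \<open>norm (e 0)\<close>, dominate \<open>e\<close> entrywise, whatever the
  signs in \<open>M\<close>.\<close>

lemma linear_path_tendsto_zero:
  fixes M W :: "real^'n::finite^'n" and e :: "nat \<Rightarrow> real^'n"
  assumes M: "\<And>i j. \<bar>M $ i $ j\<bar> \<le> W $ i $ j"
    and W: "\<And>i. (\<Sum>j\<in>UNIV. W $ i $ j) \<le> 1"
    and reach: "\<And>i. \<exists>k. (i, k) \<in> (listens W)\<^sup>* \<and> (\<Sum>j\<in>UNIV. \<bar>M $ k $ j\<bar>) < 1"
    and path: "\<And>t. e (Suc t) = M *v e t"
  shows "e \<longlonglongrightarrow> 0"
proof -
  define P :: "real^'n^'n" where "P = (\<chi> i j. \<bar>M $ i $ j\<bar>)"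
  define c where "c t = ((*v) P ^^ t) 1" for t
  have c_lim: "c \<longlonglongrightarrow> 0"
    using powers_one_tendsto_zero[of P W] M W reach by (simp add: P_def c_def[abs_def])
  have bound: "\<bar>e t $ i\<bar> \<le> norm (e 0) * c t $ i" for t i
  proof (induction t arbitrary: i)
    case 0
    show ?case by (simp add: c_def component_le_norm_cart)
  next
    case (Suc t)
    have "\<bar>e (Suc t) $ i\<bar> \<le> (\<Sum>j\<in>UNIV. \<bar>M $ i $ j * e t $ j\<bar>)"
      unfolding path matrix_vector_mult_def by simp
    also have "\<dots> \<le> (\<Sum>j\<in>UNIV. \<bar>M $ i $ j\<bar> * (norm (e 0) * c t $ j))"
      unfolding abs_mult by (intro sum_mono mult_left_mono Suc.IH) simp
    also have "\<dots> = norm (e 0) * c (Suc t) $ i"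
      by (simp add: c_def matrix_vector_mult_def P_def sum_distrib_left mult_ac)
    finally show ?case .
  qed
  show ?thesis
  proof (rule vec_tendstoI)
    fix i
    have "(\<lambda>t. norm (e 0) * c t $ i) \<longlonglongrightarrow> norm (e 0) * 0 $ i"
      by (intro tendsto_intros c_lim)
    then show "(\<lambda>t. e t $ i) \<longlonglongrightarrow> 0 $ i"
      using Lim_null_comparison[of "\<lambda>t. e t $ i" "\<lambda>t. norm (e 0) * c t $ i" sequentially] bound
      by simp
  qed
qed

text \<open>A kernel vector of \<open>mat 1 - M\<close> is a constant path of the homogeneous
  recursion, so it must be its own limit 0; in finite dimension a trivial kernel suffices.\<close>

lemma invertible_mat_1_minus:
  fixes M :: "real^'n::finite^'n"
  assumes "\<And>e. (\<And>t. e (Suc t) = M *v e t) \<Longrightarrow> e \<longlonglongrightarrow> 0"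
  shows "invertible (mat 1 - M)"
proof -
  have "x = 0" if "(mat 1 - M) *v x = 0" for x
  proof -
    have "x = M *v x"
      using that by (simp add: matrix_vector_mult_diff_rdistrib)
    then have "(\<lambda>t. x) \<longlonglongrightarrow> 0" by (intro assms)
    then show ?thesis by (simp add: LIMSEQ_const_iff)
  qed
  then show ?thesis
    unfolding invertible_left_inverse matrix_left_invertible_ker by blast
qed

lemma steady_state_iff_leontief:
  fixes M :: "real^'n::finite^'n"
  assumes "invertible (mat 1 - M)"
  shows "steady_state M s m \<longleftrightarrow> m = leontief M *v s"
proof -
  have inv: "(mat 1 - M) ** leontief M = mat 1" "leontief M ** (mat 1 - M) = mat 1"
    using someI_ex[OF assms[unfolded invertible_def]] by (simp_all add: leontief_def matrix_inv_def)
  have "steady_state M s m \<longleftrightarrow> (mat 1 - M) *v m = s"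
    by (auto simp: steady_state_def matrix_vector_mult_diff_rdistrib algebra_simps)
  also have "\<dots> \<longleftrightarrow> m = leontief M *v s"
    using inv by (metis matrix_vector_mul_assoc matrix_vector_mul_lid)
  finally show ?thesis .
qed

text \<open>Subtracting the steady state cancels the input \<open>s\<close>, so the deviation
  follows the homogeneous recursion.\<close>

lemma opinion_path_tendsto_leontief:
  fixes M :: "real^'n::finite^'n"
  assumes null: "\<And>e. (\<And>t. e (Suc t) = M *v e t) \<Longrightarrow> e \<longlonglongrightarrow> 0"
    and path: "opinion_path M s \<mu>"
  shows "\<mu> \<longlonglongrightarrow> leontief M *v s"
proof -
  let ?m = "leontief M *v s"
  have "steady_state M s ?m"
    using steady_state_iff_leontief[OF invertible_mat_1_minus[OF null]] by blast
  then have "?m = M *v ?m + s" by (simp add: steady_state_def)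
  then have "\<mu> (Suc t) - ?m = M *v (\<mu> t - ?m)" for t
    using path by (simp add: opinion_path_def matrix_vector_mult_diff_distrib algebra_simps)
  then have "(\<lambda>t. \<mu> t - ?m) \<longlonglongrightarrow> 0" by (rule null)
  then show ?thesis by (simp add: LIM_zero_iff)
qed

lemma leontief_biased_input_component:
  "(leontief M *v biased_input B \<theta> \<xi> v) $ i = b_coeff M v i * \<theta> + b_coeff_on B M v i * \<xi>"
proof -
  have "(leontief M *v biased_input B \<theta> \<xi> v) $ i
    = (\<Sum>j\<in>UNIV. leontief M $ i $ j * v $ j * \<theta>
        + (if j \<in> B then leontief M $ i $ j * v $ j * \<xi> else 0))"
    by (auto simp: matrix_vector_mult_def biased_input_def algebra_simps intro!: sum.cong)
  also have "\<dots> = b_coeff M v i * \<theta> + b_coeff_on B M v i * \<xi>"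
    by (simp add: sum.distrib b_coeff_def b_coeff_on_def sum_distrib_right
        flip: sum.inter_restrict)
  finally show ?thesis .
qed

text \<open>Membership in \<open>A\<close> has to flip at some single link of the path. This turns a
  distant out-group agent into a reachable agent with a direct out-group link.\<close>

lemma rtrancl_crosses_boundary:
  assumes "(i, j) \<in> R\<^sup>*" and "(i \<in> A) \<noteq> (j \<in> A)"
  shows "\<exists>k l. (i, k) \<in> R\<^sup>* \<and> (k, l) \<in> R \<and> (k \<in> A) \<noteq> (l \<in> A)"
  using assms by (induction rule: rtrancl_induct) blast+

lemma abs_tilde_W_le:
  assumes "\<And>i j. 0 \<le> W $ i $ j" "\<bar>\<beta>\<bar> \<le> \<alpha>"
  shows "\<bar>tilde_W A B \<alpha> \<beta> W $ i $ j\<bar> \<le> \<alpha> * W $ i $ j"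
  using assms by (auto simp: tilde_W_def abs_mult intro!: mult_right_mono)

lemma reaches_deficient_row:
  fixes W :: "real^'n::finite^'n"
  assumes partition: "A \<union> B = UNIV" "A \<inter> B = {}"
    and W: "\<And>i j. 0 \<le> W $ i $ j" "\<And>i. (\<Sum>j\<in>UNIV. W $ i $ j) \<le> 1"
    and \<alpha>: "\<alpha> \<le> 1" and \<beta>: "\<beta> \<le> 0" "\<bar>\<beta>\<bar> \<le> \<alpha>"
    and no_isolated: "no_isolated_cluster A \<alpha> \<beta> W"
  shows "\<exists>k. (i, k) \<in> (listens W)\<^sup>* \<and> (\<Sum>j\<in>UNIV. \<bar>tilde_W A B \<alpha> \<beta> W $ k $ j\<bar>) < 1"
proof -
  let ?M = "tilde_W A B \<alpha> \<beta> W"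
  have le: "\<bar>?M $ k $ j\<bar> \<le> \<alpha> * W $ k $ j" for k j
    by (rule abs_tilde_W_le[OF W(1) \<beta>(2)])
  have row: "(\<Sum>j\<in>UNIV. \<bar>?M $ k $ j\<bar>) \<le> \<alpha> * (\<Sum>j\<in>UNIV. W $ k $ j)" for k
    unfolding sum_distrib_left by (intro sum_mono le)
  show ?thesis
  proof (cases "\<alpha> = 1")
    case False
    \<comment> \<open>Every row is discounted by at least the factor \<open>\<alpha> < 1\<close>, so
      \<open>i\<close> itself is the witness.\<close>
    have "\<alpha> * (\<Sum>j\<in>UNIV. W $ i $ j) \<le> \<alpha>"
      using mult_left_mono[OF W(2)[of i], of \<alpha>] \<beta> by simp
    then have "(\<Sum>j\<in>UNIV. \<bar>?M $ i $ j\<bar>) < 1"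
      using row[of i] False \<alpha> by linarith
    then show ?thesis by blast
  next
    case True
    then obtain j where j: "(i, j) \<in> (listens W)\<^sup>*"
      and alt: "(\<Sum>k\<in>UNIV. W $ j $ k) < 1 \<or> -1 < \<beta> \<and> (i \<in> A) \<noteq> (j \<in> A)"
      using no_isolated unfolding no_isolated_cluster_def by blast
    from alt show ?thesis
    proof
      assume "(\<Sum>k\<in>UNIV. W $ j $ k) < 1"
      then show ?thesis using row[of j] True j by force
    next
      assume cross: "-1 < \<beta> \<and> (i \<in> A) \<noteq> (j \<in> A)"
      then obtain k l where k: "(i, k) \<in> (listens W)\<^sup>*" and kl: "(k, l) \<in> listens W"
        and kl_cross: "(k \<in> A) \<noteq> (l \<in> A)"
        using rtrancl_crosses_boundary[OF j] by blast
      \<comment> \<open>The crossing link is scaled by \<open>\<bar>\<beta>\<bar> < 1\<close>; this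
        one strict entry makes the whole row sum of \<open>k\<close> strictly smaller than that of
        \<open>W\<close>.\<close>
      have "?M $ k $ l = \<beta> * W $ k $ l"
        using kl_cross partition by (auto simp: tilde_W_def)
      then have "\<bar>?M $ k $ l\<bar> < W $ k $ l"
        using kl cross \<beta> mult_strict_right_mono[of "-\<beta>" 1 "W $ k $ l"]
        by (simp add: listens_def abs_mult)
      then have "(\<Sum>j\<in>UNIV. \<bar>?M $ k $ j\<bar>) < (\<Sum>j\<in>UNIV. W $ k $ j)"
        using le True by (intro sum_strict_mono_ex1) auto
      then show ?thesis using k W(2)[of k] by force
    qed
  qed
qed

theorem proposition4:
  fixes A B :: "('n::finite) set"
    and W :: "real^'n^'n" and w :: "real^'n"
    and \<alpha> \<beta> \<theta> \<xi> :: real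
  assumes partition: "A \<union> B = UNIV" "A \<inter> B = {}"
    and W_range: "\<And>i j. 0 \<le> W $ i $ j \<and> W $ i $ j \<le> 1"
    and w_range: "\<And>i. 0 \<le> w $ i \<and> w $ i \<le> 1"
    and weights: "\<And>i. (\<Sum>j\<in>UNIV - {i}. W $ i $ j) + w $ i = 1"
    and sub_stochastic: "\<And>i. (\<Sum>j\<in>UNIV. W $ i $ j) \<le> 1"
    and informed: "\<exists>i. w $ i > 0"
    and alpha: "0 \<le> \<alpha>" "\<alpha> \<le> 1"
    and beta: "-1 \<le> \<beta>" "\<beta> \<le> 0"
    and alpha_beta: "0 \<le> 1 - \<alpha> - \<beta>" "1 - \<alpha> - \<beta> \<le> 1"
    and no_isolated: "no_isolated_cluster A \<alpha> \<beta> W"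
  shows "invertible (mat 1 - tilde_W A B \<alpha> \<beta> W) \<and>
    (\<forall>\<mu>. opinion_path (tilde_W A B \<alpha> \<beta> W) (biased_input B \<theta> \<xi> (tilde_w \<alpha> \<beta> w)) \<mu> \<longrightarrow>
       \<mu> \<longlonglongrightarrow> leontief (tilde_W A B \<alpha> \<beta> W) *v biased_input B \<theta> \<xi> (tilde_w \<alpha> \<beta> w)) \<and>
    (\<forall>m. steady_state (tilde_W A B \<alpha> \<beta> W) (biased_input B \<theta> \<xi> (tilde_w \<alpha> \<beta> w)) m \<longleftrightarrow>
       m = leontief (tilde_W A B \<alpha> \<beta> W) *v biased_input B \<theta> \<xi> (tilde_w \<alpha> \<beta> w)) \<and>
    (\<forall>m. steady_state (tilde_W A B \<alpha> \<beta> W) (biased_input B \<theta> \<xi> (tilde_w \<alpha> \<beta> w)) m \<longrightarrow>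
       (\<forall>i. m $ i = b_coeff (tilde_W A B \<alpha> \<beta> W) (tilde_w \<alpha> \<beta> w) i * \<theta>
                  + b_coeff_on B (tilde_W A B \<alpha> \<beta> W) (tilde_w \<alpha> \<beta> w) i * \<xi>))"
proof -
  let ?M = "tilde_W A B \<alpha> \<beta> W"
  have W_nonneg: "0 \<le> W $ i $ j" for i j using W_range by blast
  \<comment> \<open>The bound \<open>1 - \<alpha> - \<beta> \<le> 1\<close> says exactly
    \<open>-\<beta> \<le> \<alpha>\<close>: conflict never outweighs in-group identity.\<close>
  have \<beta>_le: "\<bar>\<beta>\<bar> \<le> \<alpha>" using beta alpha_beta by linarith
  have M_le: "\<bar>?M $ i $ j\<bar> \<le> W $ i $ j" for i j
    using abs_tilde_W_le[OF W_nonneg \<beta>_le] mult_right_mono[OF alpha(2) W_nonneg]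
    by (metis mult_1 order_trans)
  note reach = reaches_deficient_row[OF partition W_nonneg sub_stochastic alpha(2) beta(2) \<beta>_le
      no_isolated]
  \<comment> \<open>This decay is the only analytic input: it yields invertibility and convergence,
    and the steady-state formulas are then linear algebra.\<close>
  have null: "e \<longlonglongrightarrow> 0" if "\<And>t. e (Suc t) = ?M *v e t" for e
    using M_le sub_stochastic reach that by (rule linear_path_tendsto_zero)
  note inv = invertible_mat_1_minus[OF null]
  show ?thesis
    using inv opinion_path_tendsto_leontief[OF null]
    by (simp add: steady_state_iff_leontief[OF inv] leontief_biased_input_component)
qed

end
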